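(* Let $a,b,c,d$ be positive real numbers with $\min\{c,d\}>\max\{a,b\}$. For $n\in\mathbb{N}$, let $P_n(x;a,b;c,d)$ and $Q_n(x;a,b;c,d)$ be, respectively, the type II multiple orthogonal polynomial and the type I function for the index of length $n$ on the step line with respect to the weight vector $\overline{\mathcal{W}}(x;a,b;c,d)$. Then, for all $n\in\mathbb{N}$, $$\frac{\mathrm{d}}{\mathrm{d}x}\big(P_{n+1}(x;a,b;c,d)\big)=(n+1)\,P_n(x;a+1,b+1;d+1,c+2)$$ and $$\frac{\mathrm{d}}{\mathrm{d}x}\big(Q_n(x;a+1,b+1;d+1,c+2)\big)=-n\,Q_{n+1}(x;a,b;c,d)\qquad (x\in(0,1)).$$
   Context: $\mathbb{N}=\{0,1,2,\dots\}$. For positive reals $a,b,c,d$ with $\delta:=c+d-a-b>0$, the function $\mathcal{W}(\cdot\,;a,b;c,d)$ on $(0,1)$ is defined by $$\mathcal{W}(x;a,b;c,d)=\frac{\Gamma(c)\Gamma(d)}{\Gamma(a)\Gamma(b)\Gamma(\delta)}\,x^{a-1}(1-x)^{\delta-1}\,{}_2F_1(c-b,d-b;\delta;1-x),$$ where ${}_2F_1(\alpha,\beta;\gamma;z)=\sum_{n\ge0}\frac{(\alpha)_n(\beta)_n}{(\gamma)_n}\frac{z^n}{n!}$ for $|z|<1$, with $(z)_n$ the Pochhammer symbol (rising factorial). (The condition $\min\{c,d\}>\max\{a,b\}$ implies $\delta>0$.) The weight vector $\overline{\mathcal{W}}(x;a,b;c,d)$ has components $w_0(x)=\mathcal{W}(x;a,b;c,d)$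 and $w_1(x)=\mathcal{W}(x;a,b+1;c+1,d)$ on $(0,1)$. The index of length $n$ on the step line is $(n_0,n_1)=(m,m)$ if $n=2m$ and $(n_0,n_1)=(m+1,m)$ if $n=2m+1$. The type II polynomial $P_n(x;a,b;c,d)$ for this index is the monic polynomial of degree $n$ such that $\int_0^1 x^kP_n(x)w_j(x)\,\mathrm{d}x=0$ for $0\le k\le n_j-1$ and $j\in\{0,1\}$. For $n\ge1$, the type I function is $Q_n(x;a,b;c,d)=A_n(x)w_0(x)+B_n(x)w_1(x)$, where $A_n,B_n$ are polynomials with $\deg A_n\le n_0-1$ and $\deg B_n\le n_1-1$ (degree $\le -1$ meaning the zero polynomial) such that $\int_0^1x^kQ_n(x)\,\mathrm{d}x=0$ for $0\le k\le n-2$ and $\int_0^1x^{n-1}Q_n(x)\,\mathrm{d}x=1$; also $Q_0=0$. For these weights and every $n$ these objects exist and are unique. *)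

theory Defs
  imports "HOL-Analysis.Analysis" "HOL-Computational_Algebra.Polynomial"
begin

definition hyp2F1 :: "real \<Rightarrow> real \<Rightarrow> real \<Rightarrow> real \<Rightarrow> real" where
  "hyp2F1 \<alpha> \<beta> \<gamma> z =
     (\<Sum>n. pochhammer \<alpha> n * pochhammer \<beta> n / pochhammer \<gamma> n * (z ^ n / fact n))"

text \<open>Only the values for \<open>0 < x < 1\<close> are meaningful.\<close>
definition weight :: "real \<Rightarrow> real \<Rightarrow> real \<Rightarrow> real \<Rightarrow> real \<Rightarrow> real" where
  "weight a b c d x =
     (let \<delta> = c + d - a - b in
        Gamma c * Gamma d / (Gamma a * Gamma b * Gamma \<delta>)
        * x powr (a - 1) * (1 - x) powr (\<delta> - 1)
        * hyp2F1 (c - b) (d - b) \<delta> (1 - x))"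

definition weight_vec :: "real \<Rightarrow> real \<Rightarrow> real \<Rightarrow> real \<Rightarrow> nat \<Rightarrow> real \<Rightarrow> real" where
  "weight_vec a b c d j =
     (if j = 0 then weight a b c d else weight a (b + 1) (c + 1) d)"

definition step_index :: "nat \<Rightarrow> nat \<Rightarrow> nat" where
  "step_index n j = (if j = 0 \<and> odd n then n div 2 + 1 else n div 2)"

text \<open>All integrals over the unit interval converge absolutely for the parameters of interest;
  \<open>has_integral\<close> makes convergence part of the conditions.\<close>

definition is_type_II :: "nat \<Rightarrow> real \<Rightarrow> real \<Rightarrow> real \<Rightarrow> real \<Rightarrow> real poly \<Rightarrow> bool" where
  "is_type_II n a b c d P \<longleftrightarrow>
     degree P = n \<and> lead_coeff P = 1 \<and>
     (\<forall>j\<in>{0, 1}. \<forall>k < step_index n j.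
        ((\<lambda>x. x ^ k * poly P x * weight_vec a b c d j x) has_integral 0) {0<..<1})"

definition type_II_poly :: "nat \<Rightarrow> real \<Rightarrow> real \<Rightarrow> real \<Rightarrow> real \<Rightarrow> real poly" where
  "type_II_poly n a b c d = (THE P. is_type_II n a b c d P)"

definition linear_form ::
  "real \<Rightarrow> real \<Rightarrow> real \<Rightarrow> real \<Rightarrow> real poly \<Rightarrow> real poly \<Rightarrow> real \<Rightarrow> real" where
  "linear_form a b c d A B x =
     poly A x * weight_vec a b c d 0 x + poly B x * weight_vec a b c d 1 x"

text \<open>Meant for \<open>n \<ge> 1\<close>. A degree bound of \<open>- 1\<close> stands for the zero polynomial.\<close>
definition is_type_I ::
  "nat \<Rightarrow> real \<Rightarrow> real \<Rightarrow> real \<Rightarrow> real \<Rightarrow> real poly \<Rightarrow> real poly \<Rightarrow> bool" where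
  "is_type_I n a b c d A B \<longleftrightarrow>
     (A = 0 \<or> degree A < step_index n 0) \<and>
     (B = 0 \<or> degree B < step_index n 1) \<and>
     (\<forall>k. k + 2 \<le> n \<longrightarrow>
        ((\<lambda>x. x ^ k * linear_form a b c d A B x) has_integral 0) {0<..<1}) \<and>
     ((\<lambda>x. x ^ (n - 1) * linear_form a b c d A B x) has_integral 1) {0<..<1}"

definition type_I_fun :: "nat \<Rightarrow> real \<Rightarrow> real \<Rightarrow> real \<Rightarrow> real \<Rightarrow> real \<Rightarrow> real" where
  "type_I_fun n a b c d x =
     (if n = 0 then 0
      else let AB = (THE AB. is_type_I n a b c d (fst AB) (snd AB))
           in linear_form a b c d (fst AB) (snd AB) x)"

end

theory Submission
  imports Defs "HOL-Real_Asymp.Real_Asymp"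
begin

text \<open>
  Let \<open>\<mu> k = (a)\<^sub>k (b)\<^sub>k / ((c)\<^sub>k (d)\<^sub>k)\<close> be the moments of \<open>w\<^sub>0\<close>. The functions
  \<open>x ^ (i div 2) * w\<^bsub>i mod 2\<^esub>\<close>, taken in the order of the step line, have moments proportional to
  \<open>\<mu> k\<close> times the product of \<open>(\<alpha>\<^sub>l + k) / (\<gamma>\<^sub>l + k)\<close> over \<open>l < i\<close>, where \<open>\<alpha> = b, a, b + 1, a + 1, \<dots>\<close> and
  \<open>\<gamma> = c, d, c + 1, d + 1, \<dots>\<close>. After clearing denominators the orthogonality relations concern
  polynomials in \<open>k\<close>: the moments of \<open>Q\<^bsub>m + 1\<^esub>\<close> must be proportional to
  \<open>\<mu> k * (\<Prod>j<m. k - j) / (\<Prod>l<m. \<gamma>\<^sub>l + k)\<close>, and the coefficients of \<open>P\<^sub>n\<close> can be read off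
  from the vanishing of \<open>n\<close>-th differences of polynomials of degree below \<open>n\<close>. The formula for
  \<open>P\<^sub>n\<close> gives its derivative at once. For type I, the primitive of \<open>- n Q\<^bsub>n + 1\<^esub>\<close> has the same
  moments as \<open>Q\<^sub>n\<close> with the shifted parameters, and a continuous integrable function on \<open>(0, 1)\<close>
  is determined by its moments.
\<close>

section \<open>Moments and primitives\<close>

text \<open>Take a polynomial \<open>g\<close> uniformly close to \<open>f\<close>. The moments
  annihilate the integral of \<open>g * f\<close>, so the integral of \<open>f * f\<close> equals
  that of \<open>(f - g) * f\<close>, which is arbitrarily small.\<close>

lemma continuous_moments_zero:
  fixes f :: "real \<Rightarrow> real"
  assumes cont: "continuous_on {0..1} f"
    and mom: "\<And>k. ((\<lambda>x. x ^ k * f x) has_integral 0) {0..1}"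
    and x: "x \<in> {0..1}"
  shows "f x = 0"
proof -
  have sq: "continuous_on {0..1} (\<lambda>x. f x * f x)"
    by (intro continuous_intros cont)
  have "bounded (f ` {0..1})"
    by (rule compact_imp_bounded[OF compact_continuous_image[OF cont]]) simp
  then obtain B where B: "B > 0" "\<And>x. x \<in> {0..1} \<Longrightarrow> \<bar>f x\<bar> \<le> B"
    by (auto simp: bounded_pos)
  have "integral {0..1} (\<lambda>x. f x * f x) \<le> 0"
  proof (rule field_le_epsilon)
    fix e :: real
    assume e: "e > 0"
    obtain g where g: "real_polynomial_function g" "\<And>x. x \<in> {0..1} \<Longrightarrow> \<bar>f x - g x\<bar> < e / B"
      using Stone_Weierstrass_real_polynomial_function[OF _ cont, of "e / B"] e B by auto
    from g(1) obtain p n where p: "g = (\<lambda>x. \<Sum>i\<le>n. p i * x ^ i)"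
      unfolding real_polynomial_function_iff_sum by auto
    have "((\<lambda>x. \<Sum>i\<le>n. p i * (x ^ i * f x)) has_integral (\<Sum>i\<le>n. p i * 0)) {0..1}"
      by (intro has_integral_sum has_integral_mult_right mom) auto
    then have gf: "((\<lambda>x. g x * f x) has_integral 0) {0..1}"
      by (simp add: p sum_distrib_left sum_distrib_right mult_ac)
    have "((\<lambda>x. f x * f x - g x * f x) has_integral integral {0..1} (\<lambda>x. f x * f x) - 0) {0..1}"
      by (intro has_integral_diff gf integrable_integral integrable_continuous_real sq)
    moreover have "((\<lambda>x. e) has_integral e) {0..1::real}"
      using has_integral_const_real[of e 0 1] by simp
    moreover have "f x * f x - g x * f x \<le> e" if "x \<in> {0..1}" for x
    proof -
      have "f x * f x - g x * f x \<le> \<bar>f x - g x\<bar> * \<bar>f x\<bar>"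
        by (metis abs_ge_self abs_mult left_diff_distrib)
      also have "\<dots> \<le> e / B * B"
        by (intro mult_mono less_imp_le[OF g(2)] B that) (use e B in auto)
      finally show ?thesis using B by simp
    qed
    ultimately have "integral {0..1} (\<lambda>x. f x * f x) - 0 \<le> e"
      by (rule has_integral_le)
    then show "integral {0..1} (\<lambda>x. f x * f x) \<le> 0 + e" by simp
  qed
  moreover have "integral {0..1} (\<lambda>x. f x * f x) \<ge> 0"
    by (intro integral_nonneg integrable_continuous_real sq) auto
  ultimately have "integral {0..1} (\<lambda>x. f x * f x) = 0" by simp
  then have "f x * f x = 0"
    using integral_eq_0_iff[OF sq] x by auto
  then show ?thesis by simp
qed

lemma primitive_has_real_derivative:
  fixes f :: "real \<Rightarrow> real"
  assumes "continuous_on {a<..<b} f" "f integrable_on {a<..<b}" "x \<in> {a<..<b}"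
  shows "((\<lambda>u. integral {a..u} f) has_real_derivative f x) (at x)"
proof -
  have int: "f integrable_on {a..b}"
    using assms(2) by (simp add: integrable_on_Icc_iff_Ioo)
  have "continuous (at x) f"
    using assms by (simp add: continuous_on_eq_continuous_at)
  then have "((\<lambda>u. integral {a..u} f) has_vector_derivative f x) (at x within {a..b})"
    using integral_has_vector_derivative_continuous_at[OF int, of x "{}"] assms(3)
    by (simp add: continuous_at_imp_continuous_at_within)
  moreover have "at x within {a..b} = at x"
    using assms(3) by (intro at_within_interior) auto
  ultimately show ?thesis
    by (simp add: has_real_derivative_iff_has_vector_derivative)
qed

text \<open>Integration by parts: the boundary term at 0 vanishes because of the factor
  \<open>x ^ Suc k\<close>, the one at 1 because \<open>f\<close> has total integral 0.\<close>

lemma primitive_moment: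
  fixes f :: "real \<Rightarrow> real"
  assumes cont: "continuous_on {0<..<1} f"
    and f: "(f has_integral 0) {0<..<1}"
    and mom: "((\<lambda>x. x ^ Suc k * f x) has_integral I) {0<..<1}"
  shows "((\<lambda>x. x ^ k * integral {0..x} f) has_integral - I / Suc k) {0<..<1}"
proof -
  let ?F = "\<lambda>x. integral {0..x} f"
  have int: "f integrable_on {0..1}"
    using f by (auto simp: has_integral_Icc_iff_Ioo integrable_on_def)
  have F1: "?F 1 = 0"
    using f by (intro integral_unique) (simp add: has_integral_Icc_iff_Ioo)
  have contF: "continuous_on {0..1} ?F"
    by (rule indefinite_integral_continuous_1[OF int])
  have "((\<lambda>x. Suc k * (x ^ k * ?F x) + x ^ Suc k * f x) has_integral
      (1 ^ Suc k * ?F 1 - 0 ^ Suc k * ?F 0)) {0..1}"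
  proof (rule fundamental_theorem_of_calculus_interior)
    fix x :: real
    assume x: "x \<in> {0<..<1}"
    have "((\<lambda>x. x ^ Suc k * ?F x) has_real_derivative Suc k * (x ^ k * ?F x) + x ^ Suc k * f x) (at x)"
      by (rule derivative_eq_intros primitive_has_real_derivative[OF cont _ x] refl)+
        (use f in \<open>auto simp: integrable_on_def\<close>)
    then show "((\<lambda>x. x ^ Suc k * ?F x) has_vector_derivative
        Suc k * (x ^ k * ?F x) + x ^ Suc k * f x) (at x)"
      by (simp add: has_real_derivative_iff_has_vector_derivative)
  qed (auto intro!: continuous_intros contF)
  then have "((\<lambda>x. Suc k * (x ^ k * ?F x) + x ^ Suc k * f x) has_integral 0) {0<..<1}"
    by (simp add: F1 has_integral_Icc_iff_Ioo del: of_nat_Suc)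
  from has_integral_diff[OF this mom]
  have "((\<lambda>x. Suc k * (x ^ k * ?F x)) has_integral - I) {0<..<1}"
    by simp
  from has_integral_mult_right[OF this, of "1 / Suc k"] show ?thesis
    by (simp add: field_simps del: of_nat_Suc)
qed

text \<open>The difference \<open>h\<close> may be unbounded near the endpoints, so uniform
  approximation is not applied to it directly. Its primitive is continuous on the closed interval
  and has vanishing moments by \<open>primitive_moment\<close>; differentiating the primitive gives
  back \<open>h\<close>.\<close>

lemma moment_determinacy:
  fixes f g :: "real \<Rightarrow> real"
  assumes cf: "continuous_on {0<..<1} f" and cg: "continuous_on {0<..<1} g"
    and f: "\<And>k. ((\<lambda>x. x ^ k * f x) has_integral I k) {0<..<1}"
    and g: "\<And>k. ((\<lambda>x. x ^ k * g x) has_integral I k) {0<..<1}"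
    and x: "x \<in> {0<..<1}"
  shows "f x = g x"
proof -
  define h where "h = (\<lambda>x. f x - g x)"
  have ch: "continuous_on {0<..<1} h"
    unfolding h_def by (intro continuous_intros cf cg)
  have hk: "((\<lambda>x. x ^ k * h x) has_integral 0) {0<..<1}" for k
    using has_integral_diff[OF f[of k] g[of k]] by (simp add: h_def algebra_simps)
  have h0: "(h has_integral 0) {0<..<1}"
    using hk[of 0] by simp
  then have int: "h integrable_on {0<..<1}"
    by (auto simp: integrable_on_def)
  have H0: "integral {0..u} h = 0" if "u \<in> {0..1}" for u
  proof (rule continuous_moments_zero[OF _ _ that])
    show "continuous_on {0..1} (\<lambda>u. integral {0..u} h)"
      using int by (intro indefinite_integral_continuous_1) (simp add: integrable_on_Icc_iff_Ioo)
    show "((\<lambda>u. u ^ k * integral {0..u} h) has_integral 0) {0..1}" for k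
      using primitive_moment[OF ch h0 hk[of "Suc k"]] by (simp add: has_integral_Icc_iff_Ioo)
  qed
  have "((\<lambda>u. integral {0..u} h) has_real_derivative h x) (at x)"
    by (rule primitive_has_real_derivative[OF ch int x])
  moreover have "((\<lambda>u. integral {0..u} h) has_real_derivative 0) (at x)"
    by (rule DERIV_cong_ev[THEN iffD1, OF refl _ refl DERIV_const[of 0]])
      (use x eventually_nhds_in_open[of "{0<..<1}" x] H0 in \<open>auto elim!: eventually_mono\<close>)
  ultimately have "h x = 0"
    by (rule DERIV_unique)
  then show ?thesis by (simp add: h_def)
qed

section \<open>Moments of the weights\<close>

lemma binomial_series_neg_exponent:
  fixes t :: real
  assumes "t \<in> {0<..<1}"
  shows "(\<lambda>n. pochhammer \<beta> n / fact n * t ^ n) sums (1 - t) powr (- \<beta>)"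
proof -
  have "(- \<beta> gchoose n) * (- t) ^ n = pochhammer \<beta> n / fact n * t ^ n" for n
  proof -
    have "(- \<beta> gchoose n) * (- t) ^ n = ((- 1) ^ n * (- 1) ^ n) * (pochhammer \<beta> n / fact n * t ^ n)"
      by (simp add: gbinomial_pochhammer power_minus[of t])
    then show ?thesis by (simp flip: power_mult_distrib)
  qed
  then show ?thesis
    using gen_binomial_real[of "- t" "- \<beta>"] assms by simp
qed

lemma Beta_shift:
  fixes x y :: real
  assumes "x > 0" "y > 0"
  shows "Beta (x + real n) y = Beta x y * pochhammer x n / pochhammer (x + y) n"
proof -
  have "pochhammer x n = Gamma (x + n) / Gamma x" "pochhammer (x + y) n = Gamma (x + y + n) / Gamma (x + y)"
    using assms by (auto intro!: pochhammer_Gamma elim!: nonpos_Ints_cases)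
  moreover have "Gamma x > 0" "Gamma (x + y) > 0"
    using assms by (auto intro!: Gamma_real_pos)
  ultimately show ?thesis
    by (simp add: Beta_def add_ac)
qed

text \<open>Since \<open>pochhammer \<beta> (Suc m) = \<beta> * pochhammer (\<beta> + 1) m\<close>
  with a nonnegative second factor, the sign is that of \<beta>. Negative \<beta> must be covered
  because the second weight leads to \<open>d - (b + 1)\<close>, of which only \<open>> - 1\<close>
  is known.\<close>

lemma tail_sign:
  fixes \<beta> :: real
  assumes "\<beta> > - 1"
  obtains \<sigma> :: real where "\<bar>\<sigma>\<bar> = 1" "\<And>n. n > 0 \<Longrightarrow> \<sigma> * pochhammer \<beta> n \<ge> 0"
proof -
  have nn: "pochhammer (\<beta> + 1) m \<ge> 0" for m
    using assms by (intro pochhammer_nonneg) auto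
  show ?thesis
  proof (cases "\<beta> \<ge> 0")
    case True
    then have "1 * pochhammer \<beta> n \<ge> 0" if "n > 0" for n
      using that nn by (cases n) (auto simp: pochhammer_rec)
    then show ?thesis by (intro that[of 1]) auto
  next
    case False
    then have "- 1 * pochhammer \<beta> n \<ge> 0" if "n > 0" for n
      using that nn by (cases n) (auto simp: pochhammer_rec mult_nonpos_nonneg)
    then show ?thesis by (intro that[of "- 1"]) auto
  qed
qed

lemma Beta_integral_open:
  fixes x y :: real
  assumes "x > 0" "y > 0"
  shows "((\<lambda>t. t powr (x - 1) * (1 - t) powr (y - 1)) has_integral Beta x y) {0<..<1}"
  using has_integral_Beta_real[OF assms] by (simp add: has_integral_Icc_iff_Ioo)

text \<open>Integrate the binomial series of \<open>(1 - t)\<^sup>-\<^sup>\<beta>\<close> against a Beta density. For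
  \<open>\<beta> > - 1\<close> all terms but the first have the same sign, which gives a dominating function.\<close>

lemma Gauss_sum:
  fixes \<alpha> \<beta> \<gamma> :: real
  assumes \<alpha>: "\<alpha> > 0" and \<beta>: "\<beta> > - 1" and \<gamma>\<alpha>: "\<gamma> > \<alpha>" and \<gamma>: "\<gamma> > \<alpha> + \<beta>"
  shows "(\<lambda>n. pochhammer \<alpha> n * pochhammer \<beta> n / (pochhammer \<gamma> n * fact n)) sums
           (Gamma \<gamma> * Gamma (\<gamma> - \<alpha> - \<beta>) / (Gamma (\<gamma> - \<alpha>) * Gamma (\<gamma> - \<beta>)))"
proof -
  define f where "f n t = pochhammer \<beta> n / fact n * (t powr (\<alpha> + real n - 1) * (1 - t) powr (\<gamma> - \<alpha> - 1))"
    for n and t :: real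
  define I where "I n = pochhammer \<beta> n / fact n * Beta (\<alpha> + real n) (\<gamma> - \<alpha>)" for n
  define u where "u t = t powr (\<alpha> - 1) * (1 - t) powr (\<gamma> - \<alpha> - 1)" for t :: real
  define v where "v t = t powr (\<alpha> - 1) * (1 - t) powr (\<gamma> - \<alpha> - \<beta> - 1)" for t :: real
  have fI: "(f n has_integral I n) {0<..<1}" for n
    unfolding f_def I_def using \<alpha> \<gamma>\<alpha> by (intro has_integral_mult_right Beta_integral_open) auto
  have u: "(u has_integral Beta \<alpha> (\<gamma> - \<alpha>)) {0<..<1}"
    unfolding u_def using \<alpha> \<gamma>\<alpha> by (intro Beta_integral_open) auto
  have v: "(v has_integral Beta \<alpha> (\<gamma> - \<alpha> - \<beta>)) {0<..<1}"
    unfolding v_def using \<alpha> \<gamma> by (intro Beta_integral_open) auto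
  have f_eq: "f n t = (pochhammer \<beta> n / fact n * t ^ n) * u t" if "t \<in> {0<..<1}" for n t
    using that by (simp add: f_def u_def powr_diff powr_add powr_realpow)
  have f_sums: "(\<lambda>n. f n t) sums v t" if t: "t \<in> {0<..<1}" for t
  proof -
    have "(\<lambda>n. (pochhammer \<beta> n / fact n * t ^ n) * u t) sums ((1 - t) powr (- \<beta>) * u t)"
      by (intro sums_mult2 binomial_series_neg_exponent t)
    moreover have "(1 - t) powr (- \<beta>) * u t = v t"
      using t by (simp add: u_def v_def mult.left_commute flip: powr_add) (simp add: algebra_simps)
    ultimately show ?thesis
      using f_eq[OF t] by simp
  qed
  obtain \<sigma> :: real where \<sigma>: "\<bar>\<sigma>\<bar> = 1" "\<And>n. n > 0 \<Longrightarrow> \<sigma> * pochhammer \<beta> n \<ge> 0"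
    using tail_sign[OF \<beta>] by blast
  have \<sigma>f: "\<sigma> * f (Suc n) t \<ge> 0" for n t
  proof -
    have "\<sigma> * f (Suc n) t = (\<sigma> * pochhammer \<beta> (Suc n)) *
        (t powr (\<alpha> + real (Suc n) - 1) * (1 - t) powr (\<gamma> - \<alpha> - 1) / fact (Suc n))"
      by (simp add: f_def)
    also have "\<dots> \<ge> 0"
      by (intro mult_nonneg_nonneg \<sigma>(2)) auto
    finally show ?thesis .
  qed
  \<comment> \<open>The first term of the series is \<open>u t\<close>. The remaining ones,
    multiplied by \<sigma>, are nonnegative, so their partial sums stay below the full tail
    \<open>\<sigma> * (v t - u t)\<close>.\<close>
  have bound: "\<bar>\<Sum>n<k. f n t\<bar> \<le> 2 * u t + v t" if t: "t \<in> {0<..<1}" for k t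
  proof (cases k)
    case (Suc m)
    have f0: "f 0 t = u t" using f_eq[OF t, of 0] by simp
    have nn: "u t \<ge> 0" "v t \<ge> 0" by (simp_all add: u_def v_def)
    have "(\<lambda>n. f (Suc n) t) sums (v t - u t)"
      using f_sums[OF t] f0 sums_Suc_iff[of "\<lambda>n. f n t" "v t - u t"] by simp
    then have s: "(\<lambda>n. \<sigma> * f (Suc n) t) sums (\<sigma> * (v t - u t))"
      by (rule sums_mult)
    have "\<bar>\<Sum>n<m. f (Suc n) t\<bar> = \<bar>\<Sum>n<m. \<sigma> * f (Suc n) t\<bar>"
      using \<sigma>(1) by (simp add: abs_mult flip: sum_distrib_left)
    also have "\<dots> = (\<Sum>n<m. \<sigma> * f (Suc n) t)"
      using \<sigma>f by (simp add: sum_nonneg)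
    also have "\<dots> \<le> \<sigma> * (v t - u t)"
      using sum_le_suminf[OF sums_summable[OF s], of "{..<m}"] \<sigma>f sums_unique[OF s] by simp
    also have "\<dots> \<le> \<bar>v t - u t\<bar>"
      using \<sigma>(1) by (metis abs_ge_self abs_mult mult_1)
    also have "\<dots> \<le> u t + v t" using nn by simp
    finally have "\<bar>\<Sum>n<m. f (Suc n) t\<bar> \<le> u t + v t" .
    moreover have "(\<Sum>n<k. f n t) = u t + (\<Sum>n<m. f (Suc n) t)"
      unfolding Suc by (subst sum.lessThan_Suc_shift) (simp add: f0)
    ultimately show ?thesis using nn by simp
  qed (simp add: u_def v_def)
  have "(\<lambda>k. integral {0<..<1} (\<lambda>t. \<Sum>n<k. f n t)) \<longlonglongrightarrow> integral {0<..<1} v"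
  proof (rule dominated_convergence)
    show "(\<lambda>t. \<Sum>n<k. f n t) integrable_on {0<..<1}" for k
      using fI by (intro integrable_sum) (auto simp: integrable_on_def)
    show "(\<lambda>t. 2 * u t + v t) integrable_on {0<..<1}"
      using has_integral_add[OF has_integral_mult_right[OF u, of 2] v] by (auto simp: integrable_on_def)
    show "norm (\<Sum>n<k. f n t) \<le> 2 * u t + v t" if "t \<in> {0<..<1}" for k t
      using bound[OF that] by simp
    show "(\<lambda>k. \<Sum>n<k. f n t) \<longlonglongrightarrow> v t" if "t \<in> {0<..<1}" for t
      using f_sums[OF that] by (simp add: sums_def)
  qed
  moreover have "integral {0<..<1} (\<lambda>t. \<Sum>n<k. f n t) = (\<Sum>n<k. I n)" for k
    by (intro integral_unique has_integral_sum fI) auto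
  ultimately have "I sums Beta \<alpha> (\<gamma> - \<alpha> - \<beta>)"
    using integral_unique[OF v] by (simp add: sums_def)
  \<comment> \<open>Dividing by the Beta integral of the zeroth term turns the Beta values into
    Pochhammer quotients.\<close>
  then have "(\<lambda>n. I n / Beta \<alpha> (\<gamma> - \<alpha>)) sums (Beta \<alpha> (\<gamma> - \<alpha> - \<beta>) / Beta \<alpha> (\<gamma> - \<alpha>))"
    by (rule sums_divide)
  moreover have "I n / Beta \<alpha> (\<gamma> - \<alpha>) = pochhammer \<alpha> n * pochhammer \<beta> n / (pochhammer \<gamma> n * fact n)" for n
  proof -
    have "Beta \<alpha> (\<gamma> - \<alpha>) \<noteq> 0"
      using \<alpha> \<gamma>\<alpha> Gamma_real_pos[of \<alpha>] Gamma_real_pos[of "\<gamma> - \<alpha>"] Gamma_real_pos[of \<gamma>]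
      by (simp add: Beta_def less_imp_neq[THEN not_sym])
    then show ?thesis
      using Beta_shift[of \<alpha> "\<gamma> - \<alpha>" n] \<alpha> \<gamma>\<alpha> by (simp add: I_def mult_ac)
  qed
  moreover have "Beta \<alpha> (\<gamma> - \<alpha> - \<beta>) / Beta \<alpha> (\<gamma> - \<alpha>) =
      Gamma \<gamma> * Gamma (\<gamma> - \<alpha> - \<beta>) / (Gamma (\<gamma> - \<alpha>) * Gamma (\<gamma> - \<beta>))"
    using \<alpha> Gamma_real_pos[of \<alpha>] by (simp add: Beta_def less_imp_neq[THEN not_sym] mult_ac)
  ultimately show ?thesis by simp
qed

section \<open>Convergence, continuity and moments of the hypergeometric weights\<close>

lemma hyp2F1_summable:
  fixes \<alpha> \<beta> \<gamma> z :: real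
  assumes \<gamma>: "\<gamma> > 0" and z: "\<bar>z\<bar> < 1"
  shows "summable (\<lambda>n. pochhammer \<alpha> n * pochhammer \<beta> n / pochhammer \<gamma> n * (z ^ n / fact n))"
    (is "summable ?f")
proof -
  define r where "r n = \<bar>(\<alpha> + real n) * (\<beta> + real n) / ((\<gamma> + real n) * (real n + 1))\<bar>" for n
  obtain c where c: "\<bar>z\<bar> < c" "c < 1" using z dense by blast
  have "r \<longlonglongrightarrow> \<bar>1\<bar>"
    unfolding r_def by (intro tendsto_rabs) real_asymp
  then have "(\<lambda>n. r n * \<bar>z\<bar>) \<longlonglongrightarrow> \<bar>1\<bar> * \<bar>z\<bar>"
    by (intro tendsto_mult_right)
  then have "(\<lambda>n. r n * \<bar>z\<bar>) \<longlonglongrightarrow> \<bar>z\<bar>"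
    by simp
  then have "\<forall>\<^sub>F n in sequentially. r n * \<bar>z\<bar> < c"
    using c(1) by (rule order_tendstoD)
  then obtain N where N: "\<And>n. n \<ge> N \<Longrightarrow> r n * \<bar>z\<bar> < c"
    by (auto simp: eventually_sequentially)
  show ?thesis
  proof (rule summable_ratio_test[OF c(2)])
    fix n assume n: "N \<le> n"
    have pos: "pochhammer \<gamma> n \<noteq> 0" "\<gamma> + real n \<noteq> 0"
      using pochhammer_pos[OF \<gamma>, of n] \<gamma> by auto
    have "?f (Suc n) = (\<alpha> + real n) * (\<beta> + real n) / ((\<gamma> + real n) * (real n + 1)) * z * ?f n"
      using pos by (simp add: pochhammer_Suc field_simps)
    then have "norm (?f (Suc n)) = r n * \<bar>z\<bar> * norm (?f n)"
      by (simp add: r_def abs_mult)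
    also have "\<dots> \<le> c * norm (?f n)"
      by (intro mult_right_mono less_imp_le[OF N[OF n]]) auto
    finally show "norm (?f (Suc n)) \<le> c * norm (?f n)" .
  qed
qed

lemma isCont_hyp2F1:
  fixes \<alpha> \<beta> \<gamma> z :: real
  assumes "\<gamma> > 0" "\<bar>z\<bar> < 1"
  shows "isCont (hyp2F1 \<alpha> \<beta> \<gamma>) z"
proof -
  obtain r where r: "\<bar>z\<bar> < r" "r < 1" using assms(2) dense by blast
  then have "summable (\<lambda>n. pochhammer \<alpha> n * pochhammer \<beta> n / pochhammer \<gamma> n * (r ^ n / fact n))"
    using assms by (intro hyp2F1_summable) auto
  then have "isCont (\<lambda>z. \<Sum>n. pochhammer \<alpha> n * pochhammer \<beta> n / (pochhammer \<gamma> n * fact n) * z ^ n) z"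
    using r by (intro isCont_powser[of _ r]) (auto simp: field_simps)
  then show ?thesis
    unfolding hyp2F1_def[abs_def] by (simp add: field_simps)
qed

lemma continuous_on_weight:
  assumes "c + d - a - b > 0"
  shows "continuous_on {0<..<1} (weight a b c d)"
proof -
  have "continuous_on {0<..<1} (\<lambda>x. hyp2F1 (c - b) (d - b) (c + d - a - b) (1 - x))"
    by (intro continuous_at_imp_continuous_on ballI isCont_o2[OF _ isCont_hyp2F1])
      (use assms in auto)
  then show ?thesis
    unfolding weight_def[abs_def] Let_def
    by (intro continuous_on_mult continuous_on_const continuous_on_powr') (auto intro!: continuous_intros)
qed

text \<open>Integrating the hypergeometric series term by term turns the moment into a Gauss sum.\<close>

lemma weight_moment:
  fixes a b c d :: real
  assumes a: "a > 0" and b: "b > 0" and d: "d > 0" and cb: "c > b" and db: "d > b - 1" and \<delta>0: "c + d - a - b > 0"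
  shows "((\<lambda>x. x ^ k * weight a b c d x) has_integral
           (pochhammer a k * pochhammer b k / (pochhammer c k * pochhammer d k))) {0<..<1}"
proof -
  define \<delta> where "\<delta> = c + d - a - b"
  \<comment> \<open>The power \<open>x ^ k\<close> is absorbed into the exponent of the Beta
    density.\<close>
  define s where "s = a + real k"
  define q where "q n = pochhammer (c - b) n * pochhammer (d - b) n / (pochhammer \<delta> n * fact n)" for n
  define f where "f n x = q n * (x powr (s - 1) * (1 - x) powr (\<delta> + real n - 1))" for n and x :: real
  define I where "I n = q n * Beta s (\<delta> + real n)" for n
  define h where "h x = x powr (s - 1) * (1 - x) powr (\<delta> - 1) * hyp2F1 (c - b) (d - b) \<delta> (1 - x)" for x
  define J where "J = Beta s \<delta> * (Gamma (s + \<delta>) * Gamma (b + real k) / (Gamma (d + real k) * Gamma (c + real k)))"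
  have \<delta>: "\<delta> > 0" and s: "s > 0" using \<delta>0 a by (simp_all add: \<delta>_def s_def)
  have c: "c > 0" using b cb by simp
  have fI: "(f n has_integral I n) {0<..<1}" for n
    unfolding f_def I_def using s \<delta> by (intro has_integral_mult_right Beta_integral_open) auto
  have f_sums: "(\<lambda>n. f n x) sums h x" if x: "x \<in> {0<..<1}" for x
  proof -
    have "(\<lambda>n. pochhammer (c - b) n * pochhammer (d - b) n / pochhammer \<delta> n * ((1 - x) ^ n / fact n))
        sums hyp2F1 (c - b) (d - b) \<delta> (1 - x)"
      unfolding hyp2F1_def using \<delta> x by (intro summable_sums hyp2F1_summable) auto
    then have "(\<lambda>n. x powr (s - 1) * (1 - x) powr (\<delta> - 1) *
        (pochhammer (c - b) n * pochhammer (d - b) n / pochhammer \<delta> n * ((1 - x) ^ n / fact n))) sums h x"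
      unfolding h_def by (rule sums_mult)
    moreover have "x powr (s - 1) * (1 - x) powr (\<delta> - 1) *
        (pochhammer (c - b) n * pochhammer (d - b) n / pochhammer \<delta> n * ((1 - x) ^ n / fact n)) = f n x" for n
      using x by (simp add: f_def q_def powr_diff powr_add powr_realpow mult_ac)
    ultimately show ?thesis by simp
  qed
  have I_sums: "I sums J"
  proof -
    have "(\<lambda>n. pochhammer (c - b) n * pochhammer (d - b) n / (pochhammer (s + \<delta>) n * fact n)) sums
        (Gamma (s + \<delta>) * Gamma (s + \<delta> - (c - b) - (d - b)) / (Gamma (s + \<delta> - (c - b)) * Gamma (s + \<delta> - (d - b))))"
      \<comment> \<open>With \<open>\<gamma> = s + \<delta>\<close>, the last two conditions of the
        Gauss sum become \<open>d + k > 0\<close> and \<open>b + k > 0\<close>.\<close>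
      using cb db b d by (intro Gauss_sum) (auto simp: s_def \<delta>_def)
    then have "(\<lambda>n. Beta s \<delta> * (pochhammer (c - b) n * pochhammer (d - b) n / (pochhammer (s + \<delta>) n * fact n))) sums J"
      unfolding J_def by (intro sums_mult) (simp add: s_def \<delta>_def algebra_simps)
    moreover have "Beta s \<delta> * (pochhammer (c - b) n * pochhammer (d - b) n / (pochhammer (s + \<delta>) n * fact n)) = I n" for n
      using Beta_shift[OF \<delta> s, of n] pochhammer_pos[OF \<delta>, of n]
      by (simp add: I_def q_def Beta_commute[of s] add.commute[of s] mult_ac)
    ultimately show ?thesis by simp
  qed
  have hJ: "(h has_integral J) {0<..<1}"
  proof -
    obtain \<sigma> :: real where \<sigma>: "\<bar>\<sigma>\<bar> = 1" "\<And>n. n > 0 \<Longrightarrow> \<sigma> * pochhammer (d - b) n \<ge> 0"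
      using tail_sign[of "d - b"] db by auto
    have \<sigma>f: "\<sigma> * f (Suc n) x \<ge> 0" for n x
    proof -
      have "\<sigma> * f (Suc n) x = (\<sigma> * pochhammer (d - b) (Suc n)) * (pochhammer (c - b) (Suc n) /
          (pochhammer \<delta> (Suc n) * fact (Suc n)) * (x powr (s - 1) * (1 - x) powr (\<delta> + real (Suc n) - 1)))"
        by (simp add: f_def q_def)
      also have "\<dots> \<ge> 0"
        using \<delta> cb by (intro mult_nonneg_nonneg \<sigma>(2) divide_nonneg_nonneg pochhammer_nonneg) auto
      finally show ?thesis .
    qed
    \<comment> \<open>The terms after the first, multiplied by \<sigma>, are nonnegative, so
      monotone convergence applies to them; the first term is added back afterwards, using
      \<open>\<sigma> * \<sigma> = 1\<close>.\<close>
    have "((\<lambda>x. \<sigma> * (h x - f 0 x)) has_integral \<sigma> * (J - I 0)) {0<..<1}"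
    proof (rule has_integral_monotone_convergence_increasing)
      show "((\<lambda>x. \<Sum>n<m. \<sigma> * f (Suc n) x) has_integral (\<Sum>n<m. \<sigma> * I (Suc n))) {0<..<1}" for m
        by (intro has_integral_sum has_integral_mult_right fI) auto
      show "(\<Sum>n<m. \<sigma> * f (Suc n) x) \<le> (\<Sum>n<Suc m. \<sigma> * f (Suc n) x)" for m x
        using \<sigma>f by simp
      show "(\<lambda>m. \<Sum>n<m. \<sigma> * f (Suc n) x) \<longlonglongrightarrow> \<sigma> * (h x - f 0 x)" if "x \<in> {0<..<1}" for x
        unfolding sums_def[symmetric] using f_sums[OF that] sums_Suc_iff[of "\<lambda>n. f n x" "h x - f 0 x"]
        by (intro sums_mult) simp
      show "(\<lambda>m. \<Sum>n<m. \<sigma> * I (Suc n)) \<longlonglongrightarrow> \<sigma> * (J - I 0)"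
        unfolding sums_def[symmetric] using I_sums sums_Suc_iff[of I "J - I 0"]
        by (intro sums_mult) simp
    qed
    from has_integral_add[OF has_integral_mult_right[OF this, of \<sigma>] fI[of 0]]
    show ?thesis using \<sigma>(1) by (simp add: abs_if algebra_simps split: if_splits)
  qed
  let ?K = "Gamma c * Gamma d / (Gamma a * Gamma b * Gamma \<delta>)"
  have "((\<lambda>x. ?K * h x) has_integral ?K * J) {0<..<1}"
    by (intro has_integral_mult_right hJ)
  moreover have "?K * h x = x ^ k * weight a b c d x" if "x \<in> {0<..<1}" for x
    using that
    by (simp add: h_def weight_def Let_def s_def powr_diff powr_add powr_realpow mult_ac flip: \<delta>_def)
  ultimately have "((\<lambda>x. x ^ k * weight a b c d x) has_integral ?K * J) {0<..<1}"
    by (subst has_integral_cong) auto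
  moreover have "?K * J = pochhammer a k * pochhammer b k / (pochhammer c k * pochhammer d k)"
  proof -
    have "z \<notin> \<int>\<^sub>\<le>\<^sub>0" if "z > 0" for z :: real
      using that by (auto elim!: nonpos_Ints_cases)
    then have "pochhammer z k = Gamma (z + k) / Gamma z" if "z > 0" for z :: real
      using that by (intro pochhammer_Gamma) auto
    moreover have "Gamma z \<noteq> 0" if "z > 0" for z :: real
      using Gamma_real_pos[OF that] by simp
    ultimately show ?thesis
      using a b c d s \<delta> by (simp add: J_def Beta_def s_def mult_ac)
  qed
  ultimately show ?thesis by simp
qed

section \<open>Interpolation by staircase products\<close>

text \<open>By Pascal's rule the difference of order \<open>Suc n\<close> of \<open>q\<close> is, up
  to sign, the difference of order \<open>n\<close> of \<open>q(x + 1) - q(x)\<close>, whose degree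
  is smaller unless \<open>q\<close> is constant, in which case it vanishes.\<close>

lemma alternating_binomial_sum_poly:
  fixes q :: "real poly"
  assumes "degree q < n"
  shows "(\<Sum>j\<le>n. (- 1) ^ j * real (n choose j) * poly q (real j)) = 0"
  using assms
proof (induction n arbitrary: q)
  case (Suc n)
  define r where "r = q \<circ>\<^sub>p [:1, 1:]"
  have poly_r: "poly r (real j) = poly q (real (Suc j))" for j
    by (simp add: r_def poly_pcompose add.commute)
  have "(\<Sum>j\<le>Suc n. (- 1) ^ j * real (Suc n choose j) * poly q (real j))
      = (\<Sum>j\<le>Suc n. (- 1) ^ j * real (n choose j) * poly q (real j))
        - (\<Sum>j\<le>n. (- 1) ^ j * real (n choose j) * poly r (real j))"
    by (subst (1 2) sum.atMost_Suc_shift)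
      (simp add: poly_r algebra_simps sum.distrib sum_negf sum_subtractf)
  also have "\<dots> = - (\<Sum>j\<le>n. (- 1) ^ j * real (n choose j) * poly (r - q) (real j))"
    by (simp add: algebra_simps sum_subtractf)
  also have "\<dots> = 0"
  proof (cases "degree q = 0")
    case True
    then obtain c where "q = [:c:]" by (auto elim: degree_eq_zeroE)
    then show ?thesis by (simp add: r_def)
  next
    case False
    have dr: "degree r = degree q"
      by (simp add: r_def degree_pcompose)
    moreover have "lead_coeff r = lead_coeff q"
      by (simp add: r_def lead_coeff_comp)
    ultimately have lr: "coeff r (degree q) = lead_coeff q"
      by simp
    have "degree (r - q) < degree q"
    proof (rule degree_lessI)
      show "r - q \<noteq> 0 \<or> 0 < degree q" using False by simp
      show "\<forall>i\<ge>degree q. coeff (r - q) i = 0"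
      proof (intro allI impI)
        fix i assume "degree q \<le> i"
        then show "coeff (r - q) i = 0"
          using dr lr by (cases "i = degree q") (auto simp: coeff_eq_0)
      qed
    qed
    then show ?thesis using Suc.IH[of "r - q"] Suc.prems by (simp del: poly_diff)
  qed
  finally show ?case .
qed auto

context
  fixes \<alpha> \<gamma> :: "nat \<Rightarrow> real"
begin

text \<open>These are the numerators of the products of
  \<open>(\<alpha> l + X) / (\<gamma> l + X)\<close> over \<open>l < i\<close>, for
  \<open>i \<le> m\<close>, brought to the common denominator made of all
  \<open>\<gamma> l + X\<close> with \<open>l < m\<close>.\<close>

definition staircase :: "nat \<Rightarrow> nat \<Rightarrow> real poly" where
  "staircase m i = (\<Prod>l<i. [:\<alpha> l, 1:]) * (\<Prod>l\<in>{i..<m}. [:\<gamma> l, 1:])"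

lemma staircase_Suc: "i \<le> m \<Longrightarrow> staircase (Suc m) i = staircase m i * [:\<gamma> m, 1:]"
  by (simp add: staircase_def mult_ac del: mult_pCons_left mult_pCons_right)

lemma degree_prod_linear: "degree (\<Prod>l\<in>A. [:f l, 1 :: real:]) = card A"
  by (subst degree_prod_sum_eq) auto

lemma degree_staircase: "i \<le> m \<Longrightarrow> degree (staircase m i) = m"
  by (simp add: staircase_def degree_mult_eq degree_prod_linear)

lemma poly_staircase_top:
  assumes "\<And>l. l \<le> m \<Longrightarrow> \<alpha> l \<noteq> \<gamma> m"
  shows "poly (staircase (Suc m) (Suc m)) (- \<gamma> m) \<noteq> 0"
  using assms by (auto simp: staircase_def poly_prod)

text \<open>Only the last element of the staircase does not vanish at \<open>- \<gamma> m\<close>, so its coefficient can be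
  read off there, and the remaining elements share the factor \<open>X + \<gamma> m\<close>.\<close>

lemma staircase_span:
  assumes ne: "\<And>l j. l \<le> j \<Longrightarrow> \<alpha> l \<noteq> \<gamma> j" and "degree N \<le> m"
  shows "\<exists>C. N = (\<Sum>i\<le>m. smult (C i) (staircase m i))"
  using assms(2)
proof (induction m arbitrary: N)
  case 0
  then obtain c where "N = [:c:]" by (auto elim: degree_eq_zeroE)
  then show ?case by (intro exI[of _ "\<lambda>_. c"]) (simp add: staircase_def)
next
  case (Suc m)
  let ?T = "staircase (Suc m) (Suc m)"
  define c where "c = poly N (- \<gamma> m) / poly ?T (- \<gamma> m)"
  have "poly (N - smult c ?T) (- \<gamma> m) = 0"
    using poly_staircase_top[of m] ne by (simp add: c_def)
  then obtain M where M: "N - smult c ?T = [:\<gamma> m, 1:] * M"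
    unfolding poly_eq_0_iff_dvd by (auto elim: dvdE)
  have "degree (N - smult c ?T) \<le> Suc m"
    by (intro degree_diff_le Suc.prems order.trans[OF degree_smult_le]) (simp add: degree_staircase)
  then have "degree M \<le> m"
    unfolding M by (cases "M = 0") (auto simp: degree_mult_eq simp del: mult_pCons_left mult_pCons_right)
  then obtain C where C: "M = (\<Sum>i\<le>m. smult (C i) (staircase m i))"
    using Suc.IH by blast
  have "N = smult c ?T + [:\<gamma> m, 1:] * M"
    using M by (simp add: algebra_simps)
  also have "[:\<gamma> m, 1:] * M = (\<Sum>i\<le>m. smult (C i) (staircase (Suc m) i))"
    by (simp add: C sum_distrib_left staircase_Suc mult_ac del: mult_pCons_left mult_pCons_right)
  also have "smult c ?T + \<dots> = (\<Sum>i\<le>Suc m. smult ((C(Suc m := c)) i) (staircase (Suc m) i))"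
    by simp
  finally show ?case by blast
qed

text \<open>As for spanning: evaluation at \<open>- \<gamma> m\<close> isolates the top coefficient,
  and the factor \<open>X + \<gamma> m\<close> can then be cancelled from the rest.\<close>

lemma staircase_independent:
  assumes ne: "\<And>l j. l \<le> j \<Longrightarrow> \<alpha> l \<noteq> \<gamma> j"
    and "(\<Sum>i\<le>m. smult (C i) (staircase m i)) = 0" and "i \<le> m"
  shows "C i = 0"
  using assms(2,3)
proof (induction m arbitrary: i)
  case 0
  then show ?case by (simp add: staircase_def)
next
  case (Suc m)
  let ?T = "staircase (Suc m) (Suc m)"
  have low: "(\<Sum>i\<le>m. smult (C i) (staircase (Suc m) i))
      = [:\<gamma> m, 1:] * (\<Sum>i\<le>m. smult (C i) (staircase m i))"
    by (simp add: sum_distrib_left staircase_Suc mult_ac del: mult_pCons_left mult_pCons_right)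
  have sum0: "[:\<gamma> m, 1:] * (\<Sum>i\<le>m. smult (C i) (staircase m i)) + smult (C (Suc m)) ?T = 0"
    using Suc.prems(1) low by simp
  have "poly ([:\<gamma> m, 1:] * (\<Sum>i\<le>m. smult (C i) (staircase m i)) + smult (C (Suc m)) ?T) (- \<gamma> m) = 0"
    unfolding sum0 by simp
  then have top: "C (Suc m) = 0"
    using poly_staircase_top[of m] ne by simp
  then have "(\<Sum>i\<le>m. smult (C i) (staircase m i)) = 0"
    using sum0 by (simp del: mult_pCons_left mult_pCons_right)
  then show ?case
    using Suc.IH[of i] Suc.prems(2) top by (cases "i = Suc m") auto
qed

lemma poly_staircase:
  assumes "i \<le> m" and "\<And>l. l < m \<Longrightarrow> \<gamma> l + s \<noteq> 0"
  shows "poly (staircase m i) s / (\<Prod>l<m. \<gamma> l + s) = (\<Prod>l<i. (\<alpha> l + s) / (\<gamma> l + s))"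
proof -
  have "(\<Prod>l<m. \<gamma> l + s) = (\<Prod>l<i. \<gamma> l + s) * (\<Prod>l\<in>{i..<m}. \<gamma> l + s)"
    using assms(1) by (metis atLeast0LessThan prod.atLeastLessThan_concat zero_le)
  moreover have "(\<Prod>l\<in>{i..<m}. \<gamma> l + s) \<noteq> 0"
    using assms by auto
  ultimately show ?thesis
    by (simp add: staircase_def poly_prod prod_dividef)
qed

end

section \<open>Type I and type II functions on the step line\<close>

text \<open>The function \<open>x ^ k\<close> times weight number \<open>j\<close> has position
  \<open>2 * k + j\<close> on the step line.\<close>

lemma step_index_less_iff:
  "k < step_index n j \<longleftrightarrow> 2 * k + j < n" if "j \<in> {0, 1}"
  using that by (auto simp: step_index_def elim!: oddE evenE)

lemma sum_step_line:
  fixes f :: "nat \<Rightarrow> 'a :: comm_monoid_add"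
  shows "(\<Sum>i<n. f i) = (\<Sum>j<step_index n 0. f (2 * j)) + (\<Sum>j<step_index n 1. f (2 * j + 1))"
proof (induction n)
  case (Suc n)
  then show ?case by (cases "even n") (auto simp: step_index_def add_ac elim!: evenE oddE)
qed (simp add: step_index_def)

lemma poly_eq_sum_lessThan:
  fixes p :: "'a :: comm_semiring_1 poly"
  assumes "p = 0 \<or> degree p < n"
  shows "poly p x = (\<Sum>j<n. coeff p j * x ^ j)"
proof (cases "p = 0")
  case False
  then have "{..degree p} \<subseteq> {..<n}" using assms by auto
  then show ?thesis
    unfolding poly_altdef by (intro sum.mono_neutral_left) (auto simp: coeff_eq_0)
qed simp

lemma degree_sum_monom_lessThan:
  fixes f :: "nat \<Rightarrow> 'a :: comm_monoid_add"
  shows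
  "(\<Sum>j<n. monom (f j) j) = 0 \<or> degree (\<Sum>j<n. monom (f j) j) < n"
proof (cases n)
  case (Suc m)
  have "degree (\<Sum>j<n. monom (f j) j) \<le> m"
    unfolding Suc by (intro degree_sum_le order.trans[OF degree_monom_le]) auto
  then show ?thesis by (simp add: Suc)
qed simp

lemma coeff_sum_monom_lessThan:
  "coeff (\<Sum>j<n. monom (f j) j) i = (if i < n then f i else 0)"
  by (simp add: coeff_sum sum.delta)

section \<open>Moments along the step line\<close>

locale weight_params =
  fixes a b c d :: real
  assumes a: "a > 0" and b: "b > 0" and ca: "c > a" and cb: "c > b" and da: "d > a" and db: "d > b"
begin

lemma c: "c > 0" and d: "d > 0"
  using a ca da by simp_all

definition \<alpha> :: "nat \<Rightarrow> real" where "\<alpha> l = (if even l then b else a) + real (l div 2)"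

definition \<gamma> :: "nat \<Rightarrow> real" where "\<gamma> l = (if even l then c else d) + real (l div 2)"

definition \<mu> :: "nat \<Rightarrow> real" where
  "\<mu> k = pochhammer a k * pochhammer b k / (pochhammer c k * pochhammer d k)"

definition ratio :: "nat \<Rightarrow> nat \<Rightarrow> real" where
  "ratio i k = (\<Prod>l<i. (\<alpha> l + real k) / (\<gamma> l + real k))"

text \<open>The constant \<open>c / b\<close> arises when the Pochhammer symbols of
  \<open>b + 1\<close> and \<open>c + 1\<close> in the moments of the second weight are rewritten
  with \<open>b\<close> and \<open>c\<close>.\<close>

definition \<kappa> :: "nat \<Rightarrow> real" where "\<kappa> i = (if even i then 1 else c / b)"

definition base :: "nat \<Rightarrow> real \<Rightarrow> real" where
  "base i x = x ^ (i div 2) * weight_vec a b c d (i mod 2) x"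

text \<open>This supplies the distinctness that the staircase lemmas assume.\<close>

lemma \<alpha>_less_\<gamma>: "l \<le> j \<Longrightarrow> \<alpha> l < \<gamma> j"
proof -
  assume "l \<le> j"
  then have "real (l div 2) \<le> real (j div 2)" by (simp add: div_le_mono)
  then show ?thesis using ca cb da db by (simp add: \<alpha>_def \<gamma>_def)
qed

lemma \<gamma>_pos: "\<gamma> l + real k > 0"
  using c d by (simp add: \<gamma>_def add_pos_nonneg)

lemma \<mu>_pos: "\<mu> k > 0"
  using a b c d by (simp add: \<mu>_def pochhammer_pos)

lemma \<mu>_Suc: "\<mu> (Suc k) = \<mu> k * ((a + k) * (b + k) / ((c + k) * (d + k)))"
  by (simp add: \<mu>_def pochhammer_Suc mult_ac)

lemma \<kappa>_pos: "\<kappa> i > 0"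
  using b c by (simp add: \<kappa>_def)

text \<open>Multiplying a weight by \<open>x ^ m\<close> shifts its moments by \<open>m\<close>,
  which amounts to \<open>2 * m\<close> positions on the step line.\<close>

lemma \<mu>_add: "\<mu> (k + m) = \<mu> k * ratio (2 * m) k"
proof (induction m)
  case (Suc m)
  have "ratio (2 * Suc m) k = ratio (2 * m) k * ((b + m + k) / (c + m + k)) * ((a + m + k) / (d + m + k))"
    by (simp add: ratio_def \<alpha>_def \<gamma>_def)
  then show ?case
    using Suc by (simp add: \<mu>_Suc add_ac mult_ac)
qed (simp add: ratio_def)

lemma weight_vec_moment:
  "((\<lambda>x. x ^ k * weight_vec a b c d 0 x) has_integral \<mu> k) {0<..<1}"
  "((\<lambda>x. x ^ k * weight_vec a b c d 1 x) has_integral c / b * \<mu> k * ((b + k) / (c + k))) {0<..<1}"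
proof -
  show "((\<lambda>x. x ^ k * weight_vec a b c d 0 x) has_integral \<mu> k) {0<..<1}"
    \<comment> \<open>No parameters are exchanged here: \<open>of\<close> follows the order of
      occurrence in \<open>weight_moment\<close>, whose premises mention \<open>d\<close> before
      \<open>c\<close>.\<close>
    using weight_moment[of a b d c k] a b c d ca cb da db by (simp add: weight_vec_def \<mu>_def)
  have "((\<lambda>x. x ^ k * weight_vec a b c d 1 x) has_integral
      (pochhammer a k * pochhammer (b + 1) k / (pochhammer (c + 1) k * pochhammer d k))) {0<..<1}"
    using weight_moment[of a "b + 1" d "c + 1" k] a b c d ca cb da db by (simp add: weight_vec_def)
  moreover have "z * pochhammer (z + 1) k = pochhammer z k * (z + k)" for z :: real
    by (metis pochhammer_Suc pochhammer_rec)
  then have "pochhammer (z + 1) k = pochhammer z k * (z + k) / z" if "z > 0" for z :: real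
    using that by (metis less_irrefl nonzero_mult_div_cancel_left)
  ultimately show "((\<lambda>x. x ^ k * weight_vec a b c d 1 x) has_integral
      c / b * \<mu> k * ((b + k) / (c + k))) {0<..<1}"
    using b c by (simp add: \<mu>_def mult_ac)
qed

lemma base_moment:
  "((\<lambda>x. x ^ k * base i x) has_integral \<mu> k * (\<kappa> i * ratio i k)) {0<..<1}"
proof (cases "even i")
  case True
  then obtain m where i: "i = 2 * m" by (elim evenE)
  show ?thesis
    using weight_vec_moment(1)[of "k + m"]
    by (simp add: i base_def \<kappa>_def \<mu>_add power_add mult_ac)
next
  case False
  then obtain m where i: "i = 2 * m + 1" by (elim oddE)
  then have m: "i div 2 = m" "i mod 2 = 1" by simp_all
  have "ratio i k = ratio (2 * m) k * ((b + (k + m)) / (c + (k + m)))"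
    by (simp add: i ratio_def \<alpha>_def \<gamma>_def add_ac)
  then show ?thesis
    using weight_vec_moment(2)[of "k + m"]
    using False by (simp add: m base_def \<kappa>_def \<mu>_add power_add mult_ac)
qed

lemma continuous_on_base: "continuous_on {0<..<1} (base i)"
proof -
  have "continuous_on {0<..<1} (weight a b c d)" "continuous_on {0<..<1} (weight a (b + 1) (c + 1) d)"
    using ca db by (auto intro!: continuous_on_weight)
  then have "continuous_on {0<..<1} (weight_vec a b c d (i mod 2))"
    by (simp add: weight_vec_def)
  then show ?thesis
    unfolding base_def[abs_def] by (intro continuous_intros)
qed

lemma combination_moment:
  "((\<lambda>x. x ^ k * (\<Sum>i\<le>m. C i * base i x)) has_integral
     \<mu> k * (\<Sum>i\<le>m. C i * \<kappa> i * ratio i k)) {0<..<1}"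
proof -
  have "((\<lambda>x. \<Sum>i\<le>m. C i * (x ^ k * base i x)) has_integral
      (\<Sum>i\<le>m. C i * (\<mu> k * (\<kappa> i * ratio i k)))) {0<..<1}"
    by (intro has_integral_sum has_integral_mult_right base_moment) auto
  then show ?thesis
    by (simp add: sum_distrib_left mult_ac)
qed

lemma poly_base_integral:
  "((\<lambda>x. poly P x * base i x) has_integral
     \<kappa> i * (\<Sum>j\<le>degree P. coeff P j * (\<mu> j * ratio i j))) {0<..<1}"
proof -
  have "((\<lambda>x. \<Sum>j\<le>degree P. coeff P j * (x ^ j * base i x)) has_integral
      (\<Sum>j\<le>degree P. coeff P j * (\<mu> j * (\<kappa> i * ratio i j)))) {0<..<1}"
    by (intro has_integral_sum has_integral_mult_right base_moment) auto
  then show ?thesis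
    by (simp add: poly_altdef sum_distrib_left sum_distrib_right mult_ac)
qed

text \<open>The moments of the type I function for index length \<open>m + 1\<close>, up to normalisation.\<close>

definition momI :: "nat \<Rightarrow> nat \<Rightarrow> real" where
  "momI m k = \<mu> k * (\<Prod>j<m. real k - real j) / (\<Prod>l<m. \<gamma> l + real k)"

lemma momI_eq_0: "k < m \<Longrightarrow> momI m k = 0"
  by (auto simp: momI_def)

lemma momI_diag: "momI m m \<noteq> 0"
proof -
  have "(\<Prod>j<m. real m - real j) \<noteq> 0" "(\<Prod>l<m. \<gamma> l + real m) \<noteq> 0"
    using \<gamma>_pos[of _ m] by (auto simp: less_imp_neq[THEN not_sym])
  then show ?thesis using \<mu>_pos[of m] by (simp add: momI_def)
qed

lemma staircase_ratio:
  "i \<le> m \<Longrightarrow> poly (staircase \<alpha> \<gamma> m i) (real k) / (\<Prod>l<m. \<gamma> l + real k) = ratio i k"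
  unfolding ratio_def using \<gamma>_pos[of _ k] by (intro poly_staircase) (auto simp: less_imp_neq[THEN not_sym])

text \<open>The numerator of \<open>momI m\<close>, a polynomial of degree \<open>m\<close> in
  \<open>k\<close>, is expanded in the staircase, and dividing by the common denominator gives the
  ratios. The identity holds for every \<open>k\<close>, which later determines all moments of the
  type I function.\<close>

lemma combination_exists:
  obtains C where "\<And>k. \<mu> k * (\<Sum>i\<le>m. C i * \<kappa> i * ratio i k) = momI m k / momI m m"
proof -
  define N where "N = smult (1 / momI m m) (\<Prod>j<m. [:- real j, 1:])"
  have "degree N \<le> m"
    unfolding N_def by (rule order.trans[OF degree_smult_le]) (simp add: degree_prod_linear)
  then obtain D where D: "N = (\<Sum>i\<le>m. smult (D i) (staircase \<alpha> \<gamma> m i))"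
    using staircase_span[of \<alpha> \<gamma> N m] \<alpha>_less_\<gamma> by (metis less_irrefl)
  show thesis
  proof (rule that)
    fix k
    have "(\<Sum>i\<le>m. D i / \<kappa> i * \<kappa> i * ratio i k) = (\<Sum>i\<le>m. D i * ratio i k)"
      using \<kappa>_pos by (intro sum.cong) (auto simp: less_imp_neq[THEN not_sym])
    also have "\<dots> = (\<Sum>i\<le>m. D i * (poly (staircase \<alpha> \<gamma> m i) k / (\<Prod>l<m. \<gamma> l + real k)))"
      by (intro sum.cong) (auto simp: staircase_ratio)
    also have "\<dots> = poly N k / (\<Prod>l<m. \<gamma> l + real k)"
      by (simp add: D poly_sum sum_divide_distrib)
    finally have eq: "(\<Sum>i\<le>m. D i / \<kappa> i * \<kappa> i * ratio i k) = poly N k / (\<Prod>l<m. \<gamma> l + real k)" .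
    show "\<mu> k * (\<Sum>i\<le>m. D i / \<kappa> i * \<kappa> i * ratio i k) = momI m k / momI m m"
      unfolding eq by (simp add: N_def momI_def poly_prod mult_ac)
  qed
qed

text \<open>The numerator over the common denominator has degree at most \<open>m\<close> but
  vanishes at the \<open>m + 1\<close> points \<open>0, ..., m\<close>, so it is zero and
  independence of the staircase applies.\<close>

lemma combination_unique:
  assumes "\<And>k. k \<le> m \<Longrightarrow> \<mu> k * (\<Sum>i\<le>m. C i * \<kappa> i * ratio i k) = 0" and "i \<le> m"
  shows "C i = 0"
proof -
  define N where "N = (\<Sum>i\<le>m. smult (C i * \<kappa> i) (staircase \<alpha> \<gamma> m i))"
  have "poly N (real k) = 0" if "k \<le> m" for k
  proof -
    have "0 = (\<Sum>i\<le>m. C i * \<kappa> i * ratio i k)"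
      using assms(1)[OF that] \<mu>_pos[of k] by simp
    also have "\<dots> = (\<Sum>i\<le>m. C i * \<kappa> i * (poly (staircase \<alpha> \<gamma> m i) k / (\<Prod>l<m. \<gamma> l + real k)))"
      by (intro sum.cong) (auto simp: staircase_ratio)
    also have "\<dots> = poly N k / (\<Prod>l<m. \<gamma> l + real k)"
      by (simp add: N_def poly_sum sum_divide_distrib)
    finally show ?thesis
      using \<gamma>_pos[of _ k] by (auto simp: less_imp_neq[THEN not_sym])
  qed
  moreover have "degree N \<le> m"
    unfolding N_def
    by (intro degree_sum_le order.trans[OF degree_smult_le]) (auto simp: degree_staircase)
  ultimately have "N = 0"
    by (intro poly_eqI_degree[of "real ` {..m}"]) (auto simp: card_image)
  then have "C i * \<kappa> i = 0"
    using staircase_independent[of \<alpha> \<gamma> "\<lambda>i. C i * \<kappa> i" m i] \<alpha>_less_\<gamma> assms(2)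
    unfolding N_def by (metis less_irrefl)
  then show ?thesis using \<kappa>_pos[of i] by simp
qed

section \<open>Type I functions\<close>

definition form_coeff :: "real poly \<Rightarrow> real poly \<Rightarrow> nat \<Rightarrow> real" where
  "form_coeff A B i = coeff (if even i then A else B) (i div 2)"

lemma linear_form_eq_combination:
  assumes "A = 0 \<or> degree A < step_index n 0" "B = 0 \<or> degree B < step_index n 1"
  shows "linear_form a b c d A B x = (\<Sum>i<n. form_coeff A B i * base i x)"
proof -
  have "form_coeff A B (2 * j) * base (2 * j) x = coeff A j * x ^ j * weight_vec a b c d 0 x"
    and "form_coeff A B (2 * j + 1) * base (2 * j + 1) x = coeff B j * x ^ j * weight_vec a b c d 1 x" for j
    by (simp_all add: form_coeff_def base_def)
  then show ?thesis
    unfolding linear_form_def poly_eq_sum_lessThan[OF assms(1)] poly_eq_sum_lessThan[OF assms(2)]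
    by (simp only: sum_step_line[where f = "\<lambda>i. form_coeff A B i * base i x"] sum_distrib_right)
qed

text \<open>The prescribed moments \<open>0, ..., 0, 1\<close> agree with
  \<open>momI m k / momI m m\<close> for \<open>k \<le> m\<close>, because \<open>momI m\<close>
  vanishes below \<open>m\<close>.\<close>

lemma is_type_I_iff:
  "is_type_I (Suc m) a b c d A B \<longleftrightarrow>
     (A = 0 \<or> degree A < step_index (Suc m) 0) \<and> (B = 0 \<or> degree B < step_index (Suc m) 1) \<and>
     (\<forall>k\<le>m. \<mu> k * (\<Sum>i\<le>m. form_coeff A B i * \<kappa> i * ratio i k) = momI m k / momI m m)"
proof (cases "(A = 0 \<or> degree A < step_index (Suc m) 0) \<and> (B = 0 \<or> degree B < step_index (Suc m) 1)")
  case True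
  then have "linear_form a b c d A B = (\<lambda>x. \<Sum>i\<le>m. form_coeff A B i * base i x)"
    using linear_form_eq_combination[of A "Suc m" B] by (simp add: lessThan_Suc_atMost fun_eq_iff)
  moreover define S where "S k = \<mu> k * (\<Sum>i\<le>m. form_coeff A B i * \<kappa> i * ratio i k)" for k
  ultimately have int: "((\<lambda>x. x ^ k * linear_form a b c d A B x) has_integral I) {0<..<1} \<longleftrightarrow> S k = I" for k I
    using combination_moment[of k "form_coeff A B" m] by (auto dest: has_integral_unique)
  have "(\<forall>k. k + 2 \<le> Suc m \<longrightarrow> S k = 0) \<and> S m = 1 \<longleftrightarrow> (\<forall>k\<le>m. S k = (if k = m then 1 else 0))"
    by auto
  moreover have "momI m k / momI m m = (if k = m then 1 else 0)" if "k \<le> m" for k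
    using that momI_diag[of m] momI_eq_0[of k m] by auto
  ultimately show ?thesis
    using True unfolding is_type_I_def int S_def[symmetric] by simp
next
  case False
  then show ?thesis by (auto simp: is_type_I_def)
qed

lemma type_I_fun_combination:
  obtains C where "type_I_fun (Suc m) a b c d = (\<lambda>x. \<Sum>i\<le>m. C i * base i x)"
    and "\<And>k. \<mu> k * (\<Sum>i\<le>m. C i * \<kappa> i * ratio i k) = momI m k / momI m m"
proof -
  let ?Q = "\<lambda>AB. is_type_I (Suc m) a b c d (fst AB) (snd AB)"
  obtain C where C: "\<And>k. \<mu> k * (\<Sum>i\<le>m. C i * \<kappa> i * ratio i k) = momI m k / momI m m"
    using combination_exists by blast
  \<comment> \<open>The coefficients at even positions of the step line belong to \<open>A\<close>,
    those at odd positions to \<open>B\<close>.\<close>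
  define A where "A = (\<Sum>j<step_index (Suc m) 0. monom (C (2 * j)) j)"
  define B where "B = (\<Sum>j<step_index (Suc m) 1. monom (C (2 * j + 1)) j)"
  have deg: "A = 0 \<or> degree A < step_index (Suc m) 0" "B = 0 \<or> degree B < step_index (Suc m) 1"
    unfolding A_def B_def by (rule degree_sum_monom_lessThan)+
  have coeffs: "form_coeff A B i = C i" if "i \<le> m" for i
    using that by (cases "even i")
      (auto simp: form_coeff_def A_def B_def coeff_sum_monom_lessThan step_index_less_iff elim!: evenE oddE)
  have Q: "?Q (A, B)"
    using deg C coeffs by (simp add: is_type_I_iff)
  have "AB = (A, B)" if AB: "?Q AB" for AB
  proof -
    obtain A' B' where [simp]: "AB = (A', B')" by (cases AB)
    have deg': "A' = 0 \<or> degree A' < step_index (Suc m) 0" "B' = 0 \<or> degree B' < step_index (Suc m) 1"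
      using AB by (auto simp: is_type_I_iff)
    have eq: "form_coeff A' B' i = form_coeff A B i" if "i \<le> m" for i
    proof -
      have "form_coeff A' B' i - form_coeff A B i = 0"
        using that AB Q
        by (intro combination_unique[where C = "\<lambda>i. form_coeff A' B' i - form_coeff A B i"])
          (auto simp: is_type_I_iff left_diff_distrib sum_subtractf right_diff_distrib)
      then show ?thesis by simp
    qed
    have "coeff A' j = coeff A j" for j
    proof (cases "j < step_index (Suc m) 0")
      case True
      then show ?thesis using eq[of "2 * j"] by (auto simp: step_index_less_iff form_coeff_def)
    next
      case False
      then show ?thesis using deg(1) deg'(1) by (auto simp: coeff_eq_0)
    qed
    moreover have "coeff B' j = coeff B j" for j
    proof (cases "j < step_index (Suc m) 1")
      case True
      then show ?thesis using eq[of "2 * j + 1"] by (auto simp: step_index_less_iff form_coeff_def)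
    next
      case False
      then show ?thesis using deg(2) deg'(2) by (auto simp: coeff_eq_0)
    qed
    ultimately show ?thesis by (simp add: poly_eq_iff)
  qed
  with Q have "(THE AB. ?Q AB) = (A, B)"
    by (rule the_equality)
  then have "type_I_fun (Suc m) a b c d x = linear_form a b c d A B x" for x
    by (simp add: type_I_fun_def)
  then have "type_I_fun (Suc m) a b c d = (\<lambda>x. \<Sum>i\<le>m. C i * base i x)"
    using linear_form_eq_combination[OF deg] coeffs by (simp add: lessThan_Suc_atMost fun_eq_iff)
  then show thesis using C by (rule that)
qed

lemma type_I_fun_moment:
  "((\<lambda>x. x ^ k * type_I_fun (Suc m) a b c d x) has_integral momI m k / momI m m) {0<..<1}"
proof -
  obtain C where "type_I_fun (Suc m) a b c d = (\<lambda>x. \<Sum>i\<le>m. C i * base i x)"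
    and "\<And>k. \<mu> k * (\<Sum>i\<le>m. C i * \<kappa> i * ratio i k) = momI m k / momI m m"
    using type_I_fun_combination by blast
  then show ?thesis
    using combination_moment[of k C m] by simp
qed

lemma continuous_on_type_I_fun: "continuous_on {0<..<1} (type_I_fun (Suc m) a b c d)"
proof -
  obtain C where "type_I_fun (Suc m) a b c d = (\<lambda>x. \<Sum>i\<le>m. C i * base i x)"
    using type_I_fun_combination by blast
  then show ?thesis by (auto intro!: continuous_intros continuous_on_base)
qed

section \<open>Type II polynomials\<close>

lemma is_type_II_iff:
  "is_type_II n a b c d P \<longleftrightarrow> degree P = n \<and> lead_coeff P = 1 \<and>
     (\<forall>i<n. (\<Sum>j\<le>n. coeff P j * (\<mu> j * ratio i j)) = 0)"
proof -
  have orth: "(\<forall>j\<in>{0, 1}. \<forall>k<step_index n j. ((\<lambda>x. x ^ k * poly P x * weight_vec a b c d j x) has_integral 0) {0<..<1})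
      \<longleftrightarrow> (\<forall>i<n. ((\<lambda>x. poly P x * base i x) has_integral 0) {0<..<1})" (is "?L \<longleftrightarrow> ?R")
  proof
    assume ?L
    show ?R
    proof (intro allI impI)
      fix i assume "i < n"
      moreover have "i mod 2 \<in> {0, 1}" by auto
      ultimately have "i mod 2 \<in> {0, 1}" "i div 2 < step_index n (i mod 2)"
        by (simp_all only: step_index_less_iff) simp
      with \<open>?L\<close> have "((\<lambda>x. x ^ (i div 2) * poly P x * weight_vec a b c d (i mod 2) x) has_integral 0) {0<..<1}"
        by (simp only:)
      then show "((\<lambda>x. poly P x * base i x) has_integral 0) {0<..<1}"
        by (simp add: base_def mult_ac)
    qed
  next
    assume ?R
    show ?L
    proof (intro ballI allI impI)
      fix j k :: nat assume j: "j \<in> {0, 1}" and "k < step_index n j"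
      then have "2 * k + j < n" by (simp add: step_index_less_iff)
      moreover have "(2 * k + j) div 2 = k" "(2 * k + j) mod 2 = j" using j by auto
      ultimately show "((\<lambda>x. x ^ k * poly P x * weight_vec a b c d j x) has_integral 0) {0<..<1}"
        using \<open>?R\<close>[rule_format, of "2 * k + j"] by (simp add: base_def mult_ac)
    qed
  qed
  have int: "((\<lambda>x. poly P x * base i x) has_integral 0) {0<..<1} \<longleftrightarrow>
      (\<Sum>j\<le>degree P. coeff P j * (\<mu> j * ratio i j)) = 0" for i
    using poly_base_integral[of P i] \<kappa>_pos[of i] by (auto dest: has_integral_unique)
  show ?thesis
    unfolding is_type_II_def orth int by auto
qed

text \<open>The coefficients of the type II polynomial, up to normalisation: with this choice the
  orthogonality relations are \<open>n\<close>-th finite differences of polynomials of degree \<open>n - 1\<close>.\<close>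

definition coeffII :: "nat \<Rightarrow> nat \<Rightarrow> real" where
  "coeffII n j = (- 1) ^ j * real (n choose j) * (\<Prod>l<n - 1. \<gamma> l + real j) / \<mu> j"

lemma coeffII_diag: "coeffII n n \<noteq> 0"
  using \<mu>_pos[of n] \<gamma>_pos[of _ n] by (auto simp: coeffII_def less_imp_neq[THEN not_sym])

text \<open>Type I and type II are dual: if the difference \<open>r\<close> has degree
  \<open>m < n\<close>, pairing it with a combination whose moments are 0 below \<open>m\<close> and
  1 at \<open>m\<close> yields its leading coefficient, while orthogonality makes the pairing
  0.\<close>

lemma is_type_II_unique:
  assumes P: "is_type_II n a b c d P" and P': "is_type_II n a b c d P'"
  shows "P = P'"
proof (rule ccontr)
  define r where "r = P - P'"
  define m where "m = degree r"
  assume "P \<noteq> P'"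
  then have "r \<noteq> 0" by (simp add: r_def)
  then have r: "coeff r m \<noteq> 0" by (simp add: m_def)
  have "coeff r i = 0" if "i \<ge> n" for i
    using that P P' by (cases "i = n") (auto simp: r_def is_type_II_iff coeff_eq_0)
  then have mn: "m < n" using r not_le by blast
  have orth: "(\<Sum>j\<le>m. coeff r j * (\<mu> j * ratio i j)) = 0" if "i < n" for i
  proof -
    have "(\<Sum>j\<le>m. coeff r j * (\<mu> j * ratio i j)) = (\<Sum>j\<le>n. coeff r j * (\<mu> j * ratio i j))"
      using mn by (intro sum.mono_neutral_left) (auto simp: m_def coeff_eq_0)
    also have "\<dots> = 0"
      using P P' that by (simp add: is_type_II_iff r_def left_diff_distrib sum_subtractf)
    finally show ?thesis .
  qed
  obtain C where C: "\<And>k. \<mu> k * (\<Sum>i\<le>m. C i * \<kappa> i * ratio i k) = momI m k / momI m m"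
    using combination_exists by blast
  have "coeff r m = (\<Sum>j\<le>m. coeff r j * (momI m j / momI m m))"
    using momI_diag[of m] momI_eq_0[of _ m] by (simp add: lessThan_Suc_atMost[symmetric])
  also have "\<dots> = (\<Sum>j\<le>m. \<Sum>i\<le>m. C i * \<kappa> i * (coeff r j * (\<mu> j * ratio i j)))"
    by (simp add: C[symmetric] sum_distrib_left mult_ac)
  also have "\<dots> = (\<Sum>i\<le>m. C i * \<kappa> i * (\<Sum>j\<le>m. coeff r j * (\<mu> j * ratio i j)))"
    by (subst sum.swap) (simp add: sum_distrib_left)
  also have "\<dots> = 0"
    using orth mn by simp
  finally show False using r by simp
qed

lemma coeff_type_II_poly: "coeff (type_II_poly n a b c d) j = coeffII n j / coeffII n n"
proof -
  define P where "P = (\<Sum>j<Suc n. monom (coeffII n j / coeffII n n) j)"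
  have coeff: "coeff P j = coeffII n j / coeffII n n" for j
    \<comment> \<open>For \<open>j > n\<close> both sides are 0, since the binomial coefficient
      vanishes.\<close>
    by (auto simp: P_def coeff_sum_monom_lessThan coeffII_def binomial_eq_0)
  have "degree P = n"
  proof (rule antisym)
    show "degree P \<le> n" using degree_sum_monom_lessThan[of "\<lambda>j. coeffII n j / coeffII n n" "Suc n"]
      by (auto simp: P_def simp del: sum.lessThan_Suc)
    show "n \<le> degree P" using coeffII_diag by (intro le_degree) (simp add: coeff)
  qed
  moreover have "(\<Sum>j\<le>n. coeff P j * (\<mu> j * ratio i j)) = 0" if "i < n" for i
  proof -
    have i: "i \<le> n - 1" using that by simp
    \<comment> \<open>The factor \<open>\<mu> j\<close> cancels, and the product in
      \<open>coeffII\<close> is the common denominator of all ratios with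
      \<open>i \<le> n - 1\<close>; a polynomial of degree \<open>n - 1\<close> remains.\<close>
    have "coeffII n j * (\<mu> j * ratio i j) =
        (- 1) ^ j * real (n choose j) * poly (staircase \<alpha> \<gamma> (n - 1) i) (real j)" for j
      using \<mu>_pos[of j] \<gamma>_pos[of _ j] staircase_ratio[OF i, of j, symmetric]
      by (auto simp: coeffII_def less_imp_neq[THEN not_sym])
    then have "(\<Sum>j\<le>n. coeff P j * (\<mu> j * ratio i j)) =
        (\<Sum>j\<le>n. (- 1) ^ j * real (n choose j) * poly (staircase \<alpha> \<gamma> (n - 1) i) (real j)) / coeffII n n"
      by (simp add: coeff sum_divide_distrib)
    also have "\<dots> = 0"
      using that i by (subst alternating_binomial_sum_poly) (auto simp: degree_staircase)
    finally show ?thesis .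
  qed
  ultimately have "is_type_II n a b c d P"
    using coeffII_diag by (simp add: is_type_II_iff coeff)
  then have "type_II_poly n a b c d = P"
    unfolding type_II_poly_def using is_type_II_unique by (intro the_equality) auto
  then show ?thesis by (simp add: coeff)
qed

end

section \<open>Shifting the parameters\<close>

context weight_params
begin

interpretation up: weight_params "a + 1" "b + 1" "d + 1" "c + 2"
  using a b ca cb da db by unfold_locales auto

text \<open>This explains the exchange in \<open>d + 1, c + 2\<close>: dropping the first entry of
  \<open>c, d, c + 1, d + 1, ...\<close> and adding 1 gives
  \<open>d + 1, c + 2, d + 2, ...\<close>.\<close>

lemma up_\<gamma>: "up.\<gamma> l = \<gamma> (Suc l) + 1"
  by (auto simp: up.\<gamma>_def \<gamma>_def elim!: evenE oddE)

lemma prod_\<gamma>_Suc: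
  "(\<Prod>l<Suc m. \<gamma> l + real (Suc k)) = (c + 1 + real k) * (\<Prod>l<m. up.\<gamma> l + real k)"
proof -
  have "\<gamma> 0 = c" by (simp add: \<gamma>_def)
  then show ?thesis
    unfolding prod.lessThan_Suc_shift up_\<gamma> by (simp add: add_ac)
qed

definition \<nu> :: real where "\<nu> = a * b / (c * d * (c + 1))"

lemma \<nu>: "\<nu> \<noteq> 0"
  using a b c d by (simp add: \<nu>_def)

lemma \<mu>_up: "\<mu> (Suc k) = \<nu> * (c + 1 + real k) * up.\<mu> k"
proof -
  have "pochhammer (c + 1) k * (c + 1 + k) = (c + 1) * pochhammer (c + 2) k"
    using pochhammer_Suc[of "c + 1" k] pochhammer_rec[of "c + 1" k] by (simp add: add_ac)
  then have "pochhammer (c + 1) k = (c + 1) * pochhammer (c + 2) k / (c + 1 + k)"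
    using c by (simp add: field_simps)
  then show ?thesis
    by (simp add: \<mu>_def up.\<mu>_def \<nu>_def pochhammer_rec mult_ac)
qed

text \<open>The factor \<open>c + 1 + k\<close> from \<open>\<mu>_up\<close> cancels against the one
  from \<open>prod_\<gamma>_Suc\<close>. The factor \<open>Suc k\<close>, split off the falling
  factorial, is the one by which \<open>primitive_moment\<close> divides.\<close>

lemma momI_up: "momI (Suc m) (Suc k) = \<nu> * real (Suc k) * up.momI m k"
proof -
  have "(\<Prod>j<Suc m. real (Suc k) - real j) = real (Suc k) * (\<Prod>j<m. real k - real j)"
    by (subst prod.lessThan_Suc_shift) simp
  then show ?thesis
    unfolding momI_def up.momI_def prod_\<gamma>_Suc \<mu>_up using c by (simp del: prod.lessThan_Suc of_nat_Suc)
qed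

text \<open>The factor \<open>c + 1 + k\<close> cancels as in \<open>momI_up\<close>. This needs a
  factor to split off the product over \<open>l < Suc n - 1\<close>, hence
  \<open>n > 0\<close>.\<close>

lemma coeffII_up:
  assumes "n > 0"
  shows "real (Suc j) * coeffII (Suc n) (Suc j) = - (real (Suc n) / \<nu>) * up.coeffII n j"
proof -
  obtain p where n: "n = Suc p" using assms gr0_implies_Suc by blast
  have "real (Suc j) * real (Suc n choose Suc j) = real (Suc n) * real (n choose j)"
    by (metis Suc_times_binomial_eq mult.commute of_nat_mult)
  moreover have "c + 1 + real j \<noteq> 0" using c by simp
  ultimately show ?thesis
    unfolding coeffII_def up.coeffII_def \<mu>_up
    by (simp add: n prod_\<gamma>_Suc del: prod.lessThan_Suc of_nat_Suc binomial_Suc_Suc)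
qed

lemma pderiv_type_II_poly:
  "pderiv (type_II_poly (Suc n) a b c d) = smult (real (Suc n)) (type_II_poly n (a + 1) (b + 1) (d + 1) (c + 2))"
proof (rule poly_eqI)
  fix j
  show "coeff (pderiv (type_II_poly (Suc n) a b c d)) j =
      coeff (smult (real (Suc n)) (type_II_poly n (a + 1) (b + 1) (d + 1) (c + 2))) j"
  proof (cases "n = 0")
    case True
    then show ?thesis
      using coeffII_diag[of 1] up.coeffII_diag[of 0]
      by (cases j) (simp_all add: coeff_pderiv coeff_type_II_poly up.coeff_type_II_poly
        coeffII_def[of _ "Suc (Suc _)"] up.coeffII_def[of _ "Suc _"])
  next
    case False
    define K where "K = - (real (Suc n) / \<nu>)"
    have K: "real (Suc i) * coeffII (Suc n) (Suc i) = K * up.coeffII n i" for i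
      using False by (simp add: coeffII_up K_def del: of_nat_Suc)
    have "K \<noteq> 0" using \<nu> by (simp add: K_def del: of_nat_Suc)
    moreover have "coeffII (Suc n) (Suc n) = K * up.coeffII n n / real (Suc n)"
      using K[of n] by (simp add: nonzero_eq_divide_eq mult.commute del: of_nat_Suc)
    ultimately have "real (Suc j) * (coeffII (Suc n) (Suc j) / coeffII (Suc n) (Suc n)) =
        real (Suc n) * (up.coeffII n j / up.coeffII n n)"
      \<comment> \<open>The constant \<open>K\<close> does not depend on the index, so it disappears
        when dividing by the leading coefficient.\<close>
      unfolding times_divide_eq_right K by (simp del: of_nat_Suc)
    then show ?thesis
      by (simp only: coeff_pderiv coeff_type_II_poly up.coeff_type_II_poly coeff_smult)
  qed
qed

lemma type_I_fun_has_real_derivative: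
  assumes x: "x \<in> {0<..<1}"
  shows "(type_I_fun n (a + 1) (b + 1) (d + 1) (c + 2) has_real_derivative
           - real n * type_I_fun (Suc n) a b c d x) (at x)"
proof (cases n)
  case 0
  then show ?thesis by (simp add: type_I_fun_def[abs_def])
next
  case (Suc m)
  let ?Q = "type_I_fun (Suc n) a b c d"
  let ?Q' = "type_I_fun n (a + 1) (b + 1) (d + 1) (c + 2)"
  let ?F = "\<lambda>x. - real n * integral {0..x} ?Q"
  \<comment> \<open>As \<open>n \<ge> 1\<close>, the vanishing integral is one of the orthogonality
    conditions on \<open>?Q\<close>; it makes the primitive vanish at 1.\<close>
  have Q0: "(?Q has_integral 0) {0<..<1}"
    using type_I_fun_moment[of 0 n] momI_eq_0[of 0 n] Suc by simp
  then have int: "?Q integrable_on {0<..<1}" by (auto simp: integrable_on_def)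
  have cont: "continuous_on {0<..<1} ?Q" by (rule continuous_on_type_I_fun)
  have dF: "(?F has_real_derivative - real n * ?Q y) (at y)" if "y \<in> {0<..<1}" for y
    using primitive_has_real_derivative[OF cont int that] by (rule DERIV_cmult)
  have "?Q' y = ?F y" if y: "y \<in> {0<..<1}" for y
  proof (rule moment_determinacy[OF _ _ _ _ y])
    show "continuous_on {0<..<1} ?Q'" unfolding Suc by (rule up.continuous_on_type_I_fun)
    show "continuous_on {0<..<1} ?F"
      by (intro continuous_at_imp_continuous_on ballI DERIV_isCont[OF dF])
    show "((\<lambda>x. x ^ k * ?Q' x) has_integral up.momI m k / up.momI m m) {0<..<1}" for k
      unfolding Suc by (rule up.type_I_fun_moment)
    show "((\<lambda>x. x ^ k * ?F x) has_integral up.momI m k / up.momI m m) {0<..<1}" for k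
    proof -
      have "((\<lambda>x. - real n * (x ^ k * integral {0..x} ?Q)) has_integral
          - real n * (- (momI n (Suc k) / momI n n) / Suc k)) {0<..<1}"
        by (intro has_integral_mult_right primitive_moment[OF cont Q0] type_I_fun_moment)
      \<comment> \<open>By \<open>momI_up\<close> the quotient on the left carries the factor
        \<open>Suc k / n\<close>, which the outer factors remove; \<nu> cancels between numerator
        and denominator.\<close>
      moreover have "- real n * (- (momI n (Suc k) / momI n n) / Suc k) = up.momI m k / up.momI m m"
        using \<nu> by (simp add: Suc momI_up del: of_nat_Suc)
      ultimately show ?thesis by (simp add: mult_ac)
    qed
  qed
  then have "\<forall>\<^sub>F y in nhds x. ?Q' y = ?F y"
    using x eventually_nhds_in_open[of "{0<..<1}" x] by (auto elim!: eventually_mono)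
  then show ?thesis
    using dF[OF x] by (subst DERIV_cong_ev[OF refl _ refl]) auto
qed

end

theorem theorem2p4:
  fixes a b c d :: real
  assumes "a > 0" and "b > 0" and "c > 0" and "d > 0"
    and "min c d > max a b"
  shows "\<forall>n::nat.
      pderiv (type_II_poly (n + 1) a b c d)
        = smult (real (n + 1)) (type_II_poly n (a + 1) (b + 1) (d + 1) (c + 2)) \<and>
      (\<forall>x\<in>{0<..<1}.
        (type_I_fun n (a + 1) (b + 1) (d + 1) (c + 2)
          has_real_derivative - real n * type_I_fun (n + 1) a b c d x) (at x))"
proof -
  interpret weight_params a b c d
    using assms by unfold_locales auto
  show ?thesis
    using pderiv_type_II_poly type_I_fun_has_real_derivative by simp
qed

end
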